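(* Let $G$ be a finite tree. Then there is no uniform avoidance coupling of two simple random walks on $G$.
   Context: A simple random walk on a graph $G=(V,E)$ moves from a vertex $v$ to each of its neighbors with probability $1/d(v)$, where $d(v)$ is the degree of $v$; $x\sim y$ means $x,y$ are adjacent. A Markovian avoidance process of two tokens $X,Y$ on $V$ is a (time-homogeneous) Markov chain $(X_t,Y_t)_{t\ge 0}$ on $V\times V$ with transition probabilities $T[(x,y)\rightarrow(x',y')]$ and stationary distribution $s$, such that $s(v,v)=0$ for all $v\in V$, and whenever $s(v,w)>0$ one has $T[(v,w)\rightarrow(w,u)]=0$ for all $u\in V$ (the tokens move in turn, $X$ first, so $X$ may not step onto the current position of $Y$). A uniform avoidance coupling of two simple random walks on $G$ is a Markovian avoidance process on $V\times V$ such that for every state $(x,y)$ with $s(x,y)>0$: $\sum_{y'\in V}T[(x,y)\rightarrow(x',y')]$ equals $1/d(x)$ if $x'\sim x$ and $0$ otherwise, and $\sum_{x'\in V}T[(x,y)\rightarrow(x',y')]$ equals $1/d(y)$ if $y'\sim y$ and $0$ otherwise. The moves of the two tokens need not be independent. *)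

theory Defs
  imports "HOL-Probability.Probability" "Graph_Theory.Digraph_Component"
begin

text \<open>
  A finite simple graph is a finite symmetric digraph without loops and multiple arcs
  (locale \<^locale>\<open>graph\<close>), each edge being a pair of opposite arcs.
  The constant \<^const>\<open>Digraph_Component.tree\<close> is unsuitable here: it forbids all directed
  cycles, and the two opposite arcs of one edge already form one. In such a digraph the
  cycles of the underlying undirected graph are the directed cycles with at least 3 arcs.
\<close>
definition finite_tree :: "('a, 'b) pre_digraph \<Rightarrow> bool" where
  "finite_tree G \<longleftrightarrow> graph G \<and> Digraph_Component.connected G \<and>
     \<not> (\<exists>p. pre_digraph.cycle G p \<and> 3 \<le> length p)"

text \<open>
  A time-homogeneous Markov chain on a set \<open>S\<close> is given by its transition kernel \<open>T\<close>, where
  the transition probability from \<open>p\<close> to \<open>q\<close> is \<^term>\<open>pmf (T p) q\<close>; values of \<open>T\<close> outside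
  \<open>S\<close> are irrelevant.
\<close>
definition markov_kernel_on :: "'s set \<Rightarrow> ('s \<Rightarrow> 's pmf) \<Rightarrow> bool" where
  "markov_kernel_on S T \<longleftrightarrow> (\<forall>p\<in>S. set_pmf (T p) \<subseteq> S)"

definition stationary_distribution_on :: "'s set \<Rightarrow> ('s \<Rightarrow> 's pmf) \<Rightarrow> 's pmf \<Rightarrow> bool" where
  "stationary_distribution_on S T s \<longleftrightarrow> set_pmf s \<subseteq> S \<and> bind_pmf s T = s"

definition markovian_avoidance_process ::
    "'a set \<Rightarrow> ('a \<times> 'a \<Rightarrow> ('a \<times> 'a) pmf) \<Rightarrow> ('a \<times> 'a) pmf \<Rightarrow> bool" where
  "markovian_avoidance_process V T s \<longleftrightarrow>
     markov_kernel_on (V \<times> V) T \<and>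
     stationary_distribution_on (V \<times> V) T s \<and>
     (\<forall>v\<in>V. pmf s (v, v) = 0) \<and>
     (\<forall>v\<in>V. \<forall>w\<in>V. pmf s (v, w) > 0 \<longrightarrow> (\<forall>u\<in>V. pmf (T (v, w)) (w, u) = 0))"

definition srw_prob :: "('a, 'b) pre_digraph \<Rightarrow> 'a \<Rightarrow> 'a \<Rightarrow> real" where
  "srw_prob G v w = (if v \<rightarrow>\<^bsub>G\<^esub> w then 1 / real (out_degree G v) else 0)"

definition uniform_avoidance_coupling ::
    "('a, 'b) pre_digraph \<Rightarrow> ('a \<times> 'a \<Rightarrow> ('a \<times> 'a) pmf) \<Rightarrow> ('a \<times> 'a) pmf \<Rightarrow> bool" where
  "uniform_avoidance_coupling G T s \<longleftrightarrow>
     markovian_avoidance_process (verts G) T s \<and>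
     (\<forall>x\<in>verts G. \<forall>y\<in>verts G. pmf s (x, y) > 0 \<longrightarrow>
        (\<forall>x'\<in>verts G. (\<Sum>y'\<in>verts G. pmf (T (x, y)) (x', y')) = srw_prob G x x') \<and>
        (\<forall>y'\<in>verts G. (\<Sum>x'\<in>verts G. pmf (T (x, y)) (x', y')) = srw_prob G y y'))"

end

theory Submission
  imports Defs
begin

text \<open>
  In a tree, exactly one neighbour of \<open>x\<close> is closer to a given vertex \<open>v \<noteq> x\<close> and all others are
  farther away, so a random walk step from \<open>x\<close> changes the distance to \<open>v\<close> by \<open>1 - 2 / deg x\<close> on
  average, and by \<open>1\<close> if \<open>v = x\<close>. As \<open>X\<close> never steps onto \<open>Y\<close>, the changes of the distance
  between the tokens caused by their two moves add up, so stationarity forces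
  \<open>E (1 - 2 / deg X) + E (1 - 2 / deg Y) \<ge> 0\<close>. On the other hand, stationarity of the mean of
  \<open>\<Sum>v. dist X v\<close> gives \<open>(n - 1) * E (1 - 2 / deg X) + 1 = 0\<close> for a tree on \<open>n\<close> vertices,
  and likewise for \<open>Y\<close>: a contradiction.
\<close>

section \<open>Graph distance\<close>

definition graph_dist :: "('a, 'b) pre_digraph \<Rightarrow> 'a \<Rightarrow> 'a \<Rightarrow> nat" where
  "graph_dist G u v = (LEAST n. (u, v) \<in> arcs_ends G ^^ n)"

locale tree_graph = graph G for G :: "('a, 'b) pre_digraph" (structure) +
  assumes reach: "\<And>u v. u \<in> verts G \<Longrightarrow> v \<in> verts G \<Longrightarrow> u \<rightarrow>\<^sup>* v"
    and acyclic: "\<And>p. cycle p \<Longrightarrow> length p < 3"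
begin

abbreviation d :: "'a \<Rightarrow> 'a \<Rightarrow> nat" where "d \<equiv> graph_dist G"

abbreviation nbrs :: "'a \<Rightarrow> 'a set" where "nbrs x \<equiv> {w. x \<rightarrow> w}"

lemma adj_sym: "u \<rightarrow> v \<Longrightarrow> v \<rightarrow> u"
  using sym_arcs by (auto simp: symmetric_def sym_def)

lemma adj_neq: "u \<rightarrow> v \<Longrightarrow> u \<noteq> v"
  using no_loops by (force simp: arcs_ends_conv)

lemma relpow_arcs_ends_sym: "(u, v) \<in> arcs_ends G ^^ n \<Longrightarrow> (v, u) \<in> arcs_ends G ^^ n"
proof (induction n arbitrary: v)
  case (Suc n)
  then obtain w where "(u, w) \<in> arcs_ends G ^^ n" "w \<rightarrow> v" by auto
  with Suc.IH adj_sym show ?case by (blast intro: relpow_Suc_I2)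
qed auto

lemma graph_dist_sym: "d u v = d v u"
  unfolding graph_dist_def using relpow_arcs_ends_sym by metis

lemma graph_dist_relpow:
  assumes "u \<in> verts G" "v \<in> verts G"
  shows "(u, v) \<in> arcs_ends G ^^ d u v"
proof -
  have "(u, v) \<in> (arcs_ends G)\<^sup>*" using reach[OF assms] by (simp add: reachable_conv)
  then obtain n where "(u, v) \<in> arcs_ends G ^^ n" by (auto simp: rtrancl_power)
  then show ?thesis unfolding graph_dist_def by (rule LeastI)
qed

lemma graph_dist_le: "(u, v) \<in> arcs_ends G ^^ n \<Longrightarrow> d u v \<le> n"
  unfolding graph_dist_def by (rule Least_le)

lemma graph_dist_self: "d u u = 0"
  using graph_dist_le[of u u 0] by simp

lemma graph_dist_eq_0:
  assumes "u \<in> verts G" "v \<in> verts G" "d u v = 0"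
  shows "u = v"
  using graph_dist_relpow[OF assms(1,2)] assms(3) by simp

lemma graph_dist_step:
  assumes "u \<rightarrow> w" "v \<in> verts G"
  shows "d u v \<le> Suc (d w v)"
proof -
  have "w \<in> verts G" using assms(1) by auto
  then show ?thesis
    using graph_dist_le relpow_Suc_I2[OF assms(1) graph_dist_relpow[OF _ assms(2)]] by blast
qed

text \<open>The first arc of a shortest walk leads to \<open>w\<close>;
  \<open>graph_dist_step\<close> rules out a gain of more than one.\<close>

lemma closer_neighbour:
  assumes "u \<in> verts G" "v \<in> verts G" "u \<noteq> v"
  obtains w where "u \<rightarrow> w" "Suc (d w v) = d u v"
proof -
  have "d u v \<noteq> 0" using graph_dist_eq_0 assms by blast
  then obtain n where n: "d u v = Suc n" by (cases "d u v") auto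
  then obtain w where w: "u \<rightarrow> w" "(w, v) \<in> arcs_ends G ^^ n"
    using graph_dist_relpow[OF assms(1,2)] by (metis relpow_Suc_D2)
  have "d w v \<le> n" using w(2) by (rule graph_dist_le)
  moreover have "d u v \<le> Suc (d w v)" using w(1) assms(2) by (rule graph_dist_step)
  ultimately show thesis using that w(1) n by simp
qed

section \<open>Distances from the neighbours of a vertex in a tree\<close>

lemma del_vert_adj: "u \<rightarrow>\<^bsub>del_vert x\<^esub> v \<longleftrightarrow> u \<rightarrow> v \<and> u \<noteq> x \<and> v \<noteq> x"
  by (auto simp: arcs_ends_conv del_vert_simps)

text \<open>On a shortest walk to \<open>t\<close>, every vertex after \<open>a\<close> is closer to
  \<open>t\<close> than \<open>a\<close>, hence closer than \<open>x\<close>, so the walk misses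
  \<open>x\<close>.\<close>

lemma reachable_avoiding:
  assumes "a \<in> verts G" "a \<noteq> x" "t \<in> verts G" "t \<noteq> x" "d a t \<le> d x t"
  shows "a \<rightarrow>\<^sup>*\<^bsub>del_vert x\<^esub> t"
  using assms
proof (induction "d a t" arbitrary: a rule: less_induct)
  case less
  interpret H: wf_digraph "del_vert x" by (rule wf_digraph_del_vert)
  show ?case
  proof (cases "a = t")
    case True
    then show ?thesis using less.prems by (auto simp: del_vert_simps)
  next
    case False
    then obtain w where w: "a \<rightarrow> w" "Suc (d w t) = d a t"
      using closer_neighbour less.prems by blast
    have "w \<noteq> x" using w(2) less.prems by auto
    then have "w \<rightarrow>\<^sup>*\<^bsub>del_vert x\<^esub> t" using less.hyps[of w] w less.prems by auto
    moreover have "a \<rightarrow>\<^bsub>del_vert x\<^esub> w" using w(1) \<open>w \<noteq> x\<close> less.prems by (simp add: del_vert_adj)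
    ultimately show ?thesis using H.adj_reachable_trans by blast
  qed
qed

text \<open>A path from \<open>a\<close> to \<open>b\<close> missing \<open>x\<close> would close up
  through \<open>x\<close> to a forbidden cycle.\<close>

lemma neighbours_not_reachable_avoiding:
  assumes "x \<rightarrow> a" "x \<rightarrow> b" "a \<noteq> b"
  shows "\<not> a \<rightarrow>\<^sup>*\<^bsub>del_vert x\<^esub> b"
proof
  assume r: "a \<rightarrow>\<^sup>*\<^bsub>del_vert x\<^esub> b"
  interpret H: wf_digraph "del_vert x" by (rule wf_digraph_del_vert)
  obtain p where p: "H.apath a p b" using r H.reachable_apath by blast
  then have pG: "apath a p b" using subgraph_apath_imp_apath subgraph_del_vert by blast
  have "set (H.awalk_verts a p) \<subseteq> verts (del_vert x)"
    using p H.awalkI_apath by blast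
  \<comment> \<open>Deleting a vertex keeps \<open>tail\<close> and \<open>head\<close>, so an arc
    list visits the same vertices in both digraphs.\<close>
  moreover have "H.awalk_verts a p = awalk_verts a p"
    by (induction p arbitrary: a) (simp_all add: del_vert_simps)
  ultimately have x: "x \<notin> set (awalk_verts a p)" by (auto simp: del_vert_simps)
  obtain e f where e: "e \<in> arcs G" "tail G e = x" "head G e = a"
    and f: "f \<in> arcs G" "tail G f = b" "head G f = x"
    using assms(1) adj_sym[OF assms(2)] by (auto simp: arcs_ends_conv)
  have aw: "awalk a p b" "distinct (awalk_verts a p)" using pG by (auto simp: apath_def)
  have "awalk a (p @ [f]) x" using aw f by (auto simp: awalk_simps)
  then have "awalk x (e # p @ [f]) x" using e by (auto simp: awalk_simps)
  moreover have "distinct (tl (awalk_verts x (e # p @ [f])))"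
    using aw x e f \<open>awalk a (p @ [f]) x\<close> by (simp add: awalk_verts_append)
  ultimately have "cycle (e # p @ [f])" unfolding cycle_def by blast
  \<comment> \<open>As \<open>a\<close> and \<open>b\<close> differ, \<open>p\<close> has an arc;
    \<open>e\<close> and \<open>f\<close> bring the length to at least three.\<close>
  moreover have "p \<noteq> []" using aw assms(3) by (auto simp: awalk_simps)
  ultimately show False using acyclic[of "e # p @ [f]"] by (cases p) auto
qed

text \<open>Two such neighbours would be joined via \<open>v\<close> without meeting
  \<open>x\<close>. Allowing equality for \<open>b\<close> excludes ties in distance as
  well.\<close>

lemma closer_neighbour_unique:
  assumes "x \<in> verts G" "v \<in> verts G" "x \<noteq> v" "x \<rightarrow> a" "x \<rightarrow> b"
    "d a v < d x v" "d b v \<le> d x v"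
  shows "a = b"
proof (rule ccontr)
  assume "a \<noteq> b"
  \<comment> \<open>Symmetry survives the deletion, so the walk from \<open>b\<close> to
    \<open>v\<close> can be reversed.\<close>
  interpret S: sym_digraph "del_vert x"
    by (intro wf_digraph.sym_digraphI wf_digraph_del_vert)
      (auto simp: symmetric_def sym_def del_vert_adj intro: adj_sym)
  have "a \<noteq> x" "b \<noteq> x" using assms(4,5) adj_neq by blast+
  then have "a \<rightarrow>\<^sup>*\<^bsub>del_vert x\<^esub> v" "b \<rightarrow>\<^sup>*\<^bsub>del_vert x\<^esub> v"
    using assms by (auto intro!: reachable_avoiding)
  then have "a \<rightarrow>\<^sup>*\<^bsub>del_vert x\<^esub> b"
    using S.symmetric_reachable' S.reachable_trans by blast
  then show False using neighbours_not_reachable_avoiding assms \<open>a \<noteq> b\<close> by blast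
qed

lemma neighbours_dist:
  assumes "x \<in> verts G" "v \<in> verts G" "x \<noteq> v"
  obtains w where "x \<rightarrow> w" "Suc (d w v) = d x v"
    "\<And>u. x \<rightarrow> u \<Longrightarrow> u \<noteq> w \<Longrightarrow> d u v = Suc (d x v)"
proof -
  obtain w where w: "x \<rightarrow> w" "Suc (d w v) = d x v"
    using closer_neighbour assms by blast
  have "d u v = Suc (d x v)" if u: "x \<rightarrow> u" "u \<noteq> w" for u
  proof -
    have "\<not> d u v \<le> d x v" using closer_neighbour_unique[OF assms w(1) u(1)] w(2) u(2) by auto
    moreover have "d u v \<le> Suc (d x v)" using graph_dist_step adj_sym u(1) assms(2) by blast
    ultimately show ?thesis by simp
  qed
  with w that show thesis by blast
qed

text \<open>Rearranged: the joint change of distance is at most the sum of the changes caused by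
  each move alone. Avoidance enters here: for adjacent tokens that swap places,
  \<open>x' = y\<close> and the inequality would read 2 <= 0.\<close>

lemma graph_dist_both_move:
  assumes "x \<rightarrow> x'" "y \<rightarrow> y'" "x \<noteq> y" "x' \<noteq> y"
  shows "d x' y' + d x y \<le> d x' y + d x y'"
proof -
  have V: "x \<in> verts G" "y \<in> verts G" "x' \<in> verts G" "y' \<in> verts G" using assms by auto
  have step_x: "d x' y' \<le> Suc (d x y')" using graph_dist_step adj_sym assms(1) V by blast
  have step_y: "d x' y' \<le> Suc (d x' y)"
    using graph_dist_step[OF adj_sym[OF assms(2)] V(3)] by (simp add: graph_dist_sym)
  obtain w where w: "x \<rightarrow> w" "Suc (d w y) = d x y"
      "\<And>u. x \<rightarrow> u \<Longrightarrow> u \<noteq> w \<Longrightarrow> d u y = Suc (d x y)"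
    using neighbours_dist V assms(3) by blast
  obtain z where z: "y \<rightarrow> z" "Suc (d z x) = d y x"
      "\<And>u. y \<rightarrow> u \<Longrightarrow> u \<noteq> z \<Longrightarrow> d u x = Suc (d y x)"
    using neighbours_dist V assms(3) by metis
  show ?thesis
  proof (cases "x' = w \<and> y' = z")
    case True
    \<comment> \<open>Both tokens approach each other. As \<open>x'\<close> is not yet
      \<open>y\<close>, some neighbour \<open>c\<close> of \<open>y\<close> is closer to
      \<open>x'\<close>; it is also closer to \<open>x\<close>, hence equals \<open>z\<close>, and
      the distance drops by 2.\<close>
    obtain c where c: "y \<rightarrow> c" "Suc (d c x') = d y x'"
      using closer_neighbour V assms(4) by metis
    have "d c x \<le> Suc (d c x')"
      using graph_dist_step[OF assms(1), of c] c(1) by (auto simp: graph_dist_sym)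
    also have "\<dots> < d y x" using c(2) w(2) True by (simp add: graph_dist_sym)
    finally have "c = z" using z(3)[OF c(1)] by fastforce
    then show ?thesis using True c(2) w(2) z(2) by (simp add: graph_dist_sym)
  next
    case False
    \<comment> \<open>One token moves away, which adds 1 on the right; the other side is covered by
      the one-step bound for that token.\<close>
    then have "d x' y = Suc (d x y) \<or> d y' x = Suc (d y x)" using w(3) z(3) assms by blast
    then show ?thesis
      using step_x step_y by (auto simp: graph_dist_sym[of y' x] graph_dist_sym[of y x])
  qed
qed

section \<open>Mean distance after a random walk step\<close>

lemma finite_nbrs: "finite (nbrs x)"
  by (rule finite_subset[OF _ finite_verts]) auto

lemma out_degree_eq_card_nbrs: "out_degree G x = card (nbrs x)"
proof -
  have "nbrs x = head G ` out_arcs G x" by (force simp: arcs_ends_conv out_arcs_def)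
  moreover have "inj_on (head G) (out_arcs G x)"
    by (auto simp: inj_on_def out_arcs_def arc_to_ends_def intro: no_multi_arcs)
  ultimately show ?thesis by (simp add: out_degree_def card_image)
qed

lemma srw_mean:
  fixes f :: "'a \<Rightarrow> real"
  shows "(\<Sum>w\<in>verts G. srw_prob G x w * f w) = (\<Sum>w\<in>nbrs x. f w) / out_degree G x"
proof -
  have "(\<Sum>w\<in>verts G. srw_prob G x w * f w) = (\<Sum>w\<in>nbrs x. srw_prob G x w * f w)"
    by (rule sum.mono_neutral_right) (auto simp: srw_prob_def)
  also have "\<dots> = (\<Sum>w\<in>nbrs x. f w / out_degree G x)"
    by (rule sum.cong) (auto simp: srw_prob_def)
  finally show ?thesis by (simp add: sum_divide_distrib)
qed

text \<open>An isolated \<open>x\<close> is excluded, since there all values of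
  \<open>srw_prob\<close> vanish and the left side would be 0.\<close>

lemma srw_mean_graph_dist:
  assumes "x \<in> verts G" "v \<in> verts G" "nbrs x \<noteq> {}"
  shows "(\<Sum>w\<in>verts G. srw_prob G x w * real (d w v)) =
    real (d x v) + 1 - (if x = v then 0 else 2 / out_degree G x)"
proof -
  have pos: "out_degree G x > 0"
    using assms(3) finite_nbrs by (simp add: out_degree_eq_card_nbrs card_gt_0_iff)
  show ?thesis
  proof (cases "x = v")
    case True
    have "d w v = 1" if "x \<rightarrow> w" for w
    proof -
      have "d w v \<le> 1" using graph_dist_step[OF adj_sym[OF that] assms(2)] True
        by (simp add: graph_dist_self)
      moreover have "w \<noteq> v" using that True adj_neq by blast
      then have "d w v \<noteq> 0" using graph_dist_eq_0[of w v] that assms(2) adj_in_verts(2) by blast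
      ultimately show ?thesis by simp
    qed
    then have "(\<Sum>w\<in>nbrs x. real (d w v)) = out_degree G x"
      by (simp add: out_degree_eq_card_nbrs)
    then show ?thesis unfolding srw_mean using pos True by (simp add: graph_dist_self)
  next
    case False
    obtain c where c: "x \<rightarrow> c" "Suc (d c v) = d x v"
        "\<And>u. x \<rightarrow> u \<Longrightarrow> u \<noteq> c \<Longrightarrow> d u v = Suc (d x v)"
      using neighbours_dist assms False by blast
    \<comment> \<open>Each neighbour is counted as farther away, and the single closer one,
      \<open>c\<close>, is corrected by 2.\<close>
    have "(\<Sum>w\<in>nbrs x. real (d w v)) = (\<Sum>w\<in>nbrs x. (real (d x v) + 1) - (if w = c then 2 else 0))"
      by (rule sum.cong) (use c in \<open>auto simp flip: c(2)\<close>)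
    also have "\<dots> = out_degree G x * (real (d x v) + 1) - 2"
      using c(1) finite_nbrs[of x] by (simp add: sum_subtractf out_degree_eq_card_nbrs)
    finally show ?thesis unfolding srw_mean using pos False by (simp add: field_simps)
  qed
qed

text \<open>Summing the distances to all vertices \<open>v\<close>: only \<open>v = x\<close> contributes no \<open>2 / deg x\<close> term.\<close>

lemma srw_mean_total_dist:
  assumes "x \<in> verts G" "nbrs x \<noteq> {}"
  shows "(\<Sum>w\<in>verts G. srw_prob G x w * (\<Sum>v\<in>verts G. real (d w v))) =
    (\<Sum>v\<in>verts G. real (d x v)) + 1 + (real (card (verts G)) - 1) * (1 - 2 / out_degree G x)"
proof -
  have "(\<Sum>w\<in>verts G. srw_prob G x w * (\<Sum>v\<in>verts G. real (d w v))) =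
      (\<Sum>v\<in>verts G. \<Sum>w\<in>verts G. srw_prob G x w * real (d w v))"
    by (simp add: sum_distrib_left) (rule sum.swap)
  also have "\<dots> = (\<Sum>v\<in>verts G. (real (d x v) + (1 - 2 / out_degree G x))
      + (if v = x then 2 / out_degree G x else 0))"
    by (rule sum.cong) (use assms srw_mean_graph_dist in auto)
  also have "\<dots> = (\<Sum>v\<in>verts G. real (d x v)) + card (verts G) * (1 - 2 / out_degree G x)
      + 2 / out_degree G x"
    using assms by (simp only: sum.distrib) simp
  \<comment> \<open>One of the \<open>card (verts G)\<close> copies of
    \<open>1 - 2 / out_degree G x\<close> combines with the correction to the constant 1.\<close>
  finally show ?thesis by (simp add: algebra_simps diff_divide_distrib)
qed

end

text \<open>\<open>connected\<close> ignores the direction of arcs; symmetry of the arcs upgrades it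
  to reachability between all vertices.\<close>

lemma finite_tree_imp_tree_graph:
  assumes "finite_tree G"
  shows "tree_graph G"
proof -
  interpret graph G using assms by (simp add: finite_tree_def)
  have "strongly_connected G"
    using assms sym_arcs symmetric_connected_imp_strongly_connected by (simp add: finite_tree_def)
  then show ?thesis
    using assms by unfold_locales (auto simp: strongly_connected_def finite_tree_def not_le[symmetric])
qed

text \<open>Stationarity tested against a function: one step leaves the mean of \<open>F\<close>
  unchanged.\<close>

lemma stationary_mean:
  fixes F :: "'s \<Rightarrow> real"
  assumes "finite S" "stationary_distribution_on S T s"
  shows "(\<Sum>p\<in>S. pmf s p * (\<Sum>q\<in>S. pmf (T p) q * F q)) = (\<Sum>q\<in>S. pmf s q * F q)"
proof -
  have step: "pmf s q = (\<Sum>p\<in>S. pmf s p * pmf (T p) q)" for q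
  proof -
    have "pmf s q = pmf (bind_pmf s T) q" using assms(2) by (simp add: stationary_distribution_on_def)
    also have "\<dots> = (\<Sum>p\<in>S. pmf (T p) q * pmf s p)"
      unfolding pmf_bind using assms
      by (intro integral_measure_pmf_real) (auto simp: stationary_distribution_on_def)
    finally show ?thesis by (simp add: mult.commute)
  qed
  have "(\<Sum>q\<in>S. pmf s q * F q) = (\<Sum>q\<in>S. (\<Sum>p\<in>S. pmf s p * pmf (T p) q) * F q)"
    by (intro sum.cong refl) (subst step, rule refl)
  also have "\<dots> = (\<Sum>q\<in>S. \<Sum>p\<in>S. pmf s p * pmf (T p) q * F q)"
    by (simp add: sum_distrib_right)
  also have "\<dots> = (\<Sum>p\<in>S. \<Sum>q\<in>S. pmf s p * pmf (T p) q * F q)"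
    by (rule sum.swap)
  finally show ?thesis by (simp add: sum_distrib_left mult.assoc)
qed

section \<open>Single steps of an avoidance coupling on a tree\<close>

locale tree_coupling = tree_graph G for G :: "('a, 'b) pre_digraph" (structure) +
  fixes T :: "'a \<times> 'a \<Rightarrow> ('a \<times> 'a) pmf" and s :: "('a \<times> 'a) pmf"
  assumes coupling: "uniform_avoidance_coupling G T s"
begin

abbreviation VV :: "('a \<times> 'a) set" where "VV \<equiv> verts G \<times> verts G"

lemma stationary: "stationary_distribution_on VV T s"
  using coupling by (simp add: uniform_avoidance_coupling_def markovian_avoidance_process_def)

lemma marginals:
  assumes "p \<in> set_pmf s" "z \<in> verts G"
  shows "(\<Sum>y'\<in>verts G. pmf (T p) (z, y')) = srw_prob G (fst p) z"
    and "(\<Sum>x'\<in>verts G. pmf (T p) (x', z)) = srw_prob G (snd p) z"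
proof -
  have "p \<in> VV" using assms(1) stationary by (auto simp: stationary_distribution_on_def)
  moreover have "pmf s p > 0" using assms(1) by (simp add: pmf_positive)
  ultimately show "(\<Sum>y'\<in>verts G. pmf (T p) (z, y')) = srw_prob G (fst p) z"
    "(\<Sum>x'\<in>verts G. pmf (T p) (x', z)) = srw_prob G (snd p) z"
    using coupling assms(2) by (auto simp: uniform_avoidance_coupling_def)
qed

text \<open>A function of one token sees only that token's marginal, so any dependence between the
  two moves drops out.\<close>

lemma mean_fst:
  assumes "p \<in> set_pmf s"
  shows "(\<Sum>q\<in>VV. pmf (T p) q * f (fst q)) = (\<Sum>w\<in>verts G. srw_prob G (fst p) w * f w)"
proof -
  have "(\<Sum>q\<in>VV. pmf (T p) q * f (fst q)) = (\<Sum>w\<in>verts G. \<Sum>y'\<in>verts G. pmf (T p) (w, y') * f w)"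
    by (simp add: sum.cartesian_product case_prod_unfold)
  also have "\<dots> = (\<Sum>w\<in>verts G. srw_prob G (fst p) w * f w)"
    by (rule sum.cong) (use marginals(1)[OF assms] in \<open>auto simp flip: sum_distrib_right\<close>)
  finally show ?thesis .
qed

lemma mean_snd:
  assumes "p \<in> set_pmf s"
  shows "(\<Sum>q\<in>VV. pmf (T p) q * f (snd q)) = (\<Sum>w\<in>verts G. srw_prob G (snd p) w * f w)"
proof -
  have "(\<Sum>q\<in>VV. pmf (T p) q * f (snd q)) = (\<Sum>x'\<in>verts G. \<Sum>w\<in>verts G. pmf (T p) (x', w) * f w)"
    by (simp add: sum.cartesian_product case_prod_unfold)
  also have "\<dots> = (\<Sum>w\<in>verts G. \<Sum>x'\<in>verts G. pmf (T p) (x', w) * f w)"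
    by (rule sum.swap)
  also have "\<dots> = (\<Sum>w\<in>verts G. srw_prob G (snd p) w * f w)"
    by (rule sum.cong) (use marginals(2)[OF assms] in \<open>auto simp flip: sum_distrib_right\<close>)
  finally show ?thesis .
qed

lemma state:
  assumes "p \<in> set_pmf s"
  shows "fst p \<in> verts G" "snd p \<in> verts G" "fst p \<noteq> snd p"
proof -
  show *: "fst p \<in> verts G" "snd p \<in> verts G"
    using assms stationary by (auto simp: stationary_distribution_on_def)
  show "fst p \<noteq> snd p"
  proof
    assume "fst p = snd p"
    then have "p = (fst p, fst p)" by (simp add: prod_eq_iff)
    moreover have "pmf s (fst p, fst p) = 0"
      using * coupling by (simp add: uniform_avoidance_coupling_def markovian_avoidance_process_def)
    ultimately show False using assms by (simp add: set_pmf_iff)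
  qed
qed

text \<open>The tokens occupy distinct vertices of a connected graph, so neither vertex is
  isolated.\<close>

lemma nbrs_ne:
  assumes "p \<in> set_pmf s"
  shows "nbrs (fst p) \<noteq> {}" "nbrs (snd p) \<noteq> {}"
proof -
  note V = state[OF assms]
  obtain w where "fst p \<rightarrow> w" using closer_neighbour[OF V] by blast
  then show "nbrs (fst p) \<noteq> {}" by blast
  obtain w where "snd p \<rightarrow> w" using closer_neighbour[OF V(2,1) V(3)[symmetric]] by blast
  then show "nbrs (snd p) \<noteq> {}" by blast
qed

lemma transition:
  assumes "p \<in> set_pmf s" "q \<in> set_pmf (T p)"
  shows "q \<in> VV" "fst p \<rightarrow> fst q" "snd p \<rightarrow> snd q" "fst q \<noteq> snd p"
proof -
  have pV: "p \<in> VV" using state[OF assms(1)] by (simp add: mem_Times_iff)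
  have ps: "pmf s p > 0" using assms(1) by (simp add: pmf_positive)
  show qV: "q \<in> VV"
    using coupling pV assms(2)
    by (auto simp: uniform_avoidance_coupling_def markovian_avoidance_process_def markov_kernel_on_def)
  have pos: "pmf (T p) (fst q, snd q) > 0" using assms(2) by (simp add: pmf_positive)
  \<comment> \<open>A joint probability is at most its marginal, so a possible move has positive
    \<open>srw_prob\<close> and follows an arc.\<close>
  have "pmf (T p) (fst q, snd q) \<le> (\<Sum>y'\<in>verts G. pmf (T p) (fst q, y'))"
    using qV by (intro member_le_sum) auto
  then have "srw_prob G (fst p) (fst q) > 0"
    using marginals(1)[OF assms(1)] qV pos by (simp add: mem_Times_iff)
  then show "fst p \<rightarrow> fst q" by (simp add: srw_prob_def split: if_splits)
  have "pmf (T p) (fst q, snd q) \<le> (\<Sum>x'\<in>verts G. pmf (T p) (x', snd q))"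
    using qV by (intro member_le_sum[of "fst q"]) auto
  then have "srw_prob G (snd p) (snd q) > 0"
    using marginals(2)[OF assms(1)] qV pos by (simp add: mem_Times_iff)
  then show "snd p \<rightarrow> snd q" by (simp add: srw_prob_def split: if_splits)
  have "pmf (T (fst p, snd p)) (snd p, snd q) = 0"
  proof -
    have "\<forall>v\<in>verts G. \<forall>w\<in>verts G. pmf s (v, w) > 0 \<longrightarrow> (\<forall>u\<in>verts G. pmf (T (v, w)) (w, u) = 0)"
      using coupling unfolding uniform_avoidance_coupling_def markovian_avoidance_process_def by blast
    moreover have "pmf s (fst p, snd p) > 0" using ps by simp
    ultimately show ?thesis using pV qV unfolding mem_Times_iff by blast
  qed
  then show "fst q \<noteq> snd p" using pos by (metis less_irrefl prod.collapse)
qed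

text \<open>The mean change of the distance of a token at \<open>x\<close> to any fixed vertex other than \<open>x\<close>.\<close>

definition drift :: "'a \<Rightarrow> real" where
  "drift x = 1 - 2 / real (out_degree G x)"

text \<open>Averaging \<open>graph_dist_both_move\<close> replaces the joint distance by distances
  of each token to the other's old position, which the marginals determine.\<close>

lemma mean_dist_le:
  assumes "p \<in> set_pmf s"
  shows "(\<Sum>q\<in>VV. pmf (T p) q * real (d (fst q) (snd q))) \<le>
    real (d (fst p) (snd p)) + drift (fst p) + drift (snd p)"
proof -
  let ?x = "fst p" and ?y = "snd p"
  note V = state[OF assms]
  have sub: "set_pmf (T p) \<subseteq> VV" using transition(1)[OF assms] by blast
  have one: "(\<Sum>q\<in>VV. pmf (T p) q) = 1" by (rule sum_pmf_eq_1) (use sub in auto)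
  have "(\<Sum>q\<in>VV. pmf (T p) q * real (d (fst q) (snd q))) \<le>
      (\<Sum>q\<in>VV. pmf (T p) q * (real (d (fst q) ?y) + real (d (snd q) ?x) - real (d ?x ?y)))"
  proof (rule sum_mono)
    fix q
    show "pmf (T p) q * real (d (fst q) (snd q)) \<le>
        pmf (T p) q * (real (d (fst q) ?y) + real (d (snd q) ?x) - real (d ?x ?y))"
    \<comment> \<open>Adjacency and avoidance are known only on the support; elsewhere both sides
      are 0.\<close>
    proof (cases "q \<in> set_pmf (T p)")
      case True
      have "d (fst q) (snd q) + d ?x ?y \<le> d (fst q) ?y + d ?x (snd q)"
        using transition[OF assms True] V(3) by (intro graph_dist_both_move)
      then show ?thesis by (intro mult_left_mono) (auto simp: graph_dist_sym[of ?x "snd q"])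
    qed (simp add: set_pmf_iff)
  qed
  also have "\<dots> = (\<Sum>q\<in>VV. pmf (T p) q * real (d (fst q) ?y))
      + (\<Sum>q\<in>VV. pmf (T p) q * real (d (snd q) ?x)) - (\<Sum>q\<in>VV. pmf (T p) q) * real (d ?x ?y)"
    by (simp add: algebra_simps sum.distrib sum_subtractf sum_distrib_left)
  also have "\<dots> = real (d ?x ?y) + drift ?x + drift ?y"
    unfolding one mean_fst[OF assms, of "\<lambda>w. real (d w ?y)"] mean_snd[OF assms, of "\<lambda>w. real (d w ?x)"]
    using V nbrs_ne[OF assms]
    by (simp add: srw_mean_graph_dist drift_def graph_dist_sym[of ?y ?x])
  finally show ?thesis .
qed

section \<open>Stationary averages of the drift and the contradiction\<close>

lemma sum_s_cong:
  assumes "\<And>p. p \<in> set_pmf s \<Longrightarrow> f p = g p"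
  shows "(\<Sum>p\<in>VV. pmf s p * f p) = (\<Sum>p\<in>VV. pmf s p * (g p :: real))"
  using assms by (intro sum.cong refl) (metis mult_zero_left set_pmf_iff)

lemma sum_s: "(\<Sum>p\<in>VV. pmf s p) = 1"
  using stationary by (intro sum_pmf_eq_1) (auto simp: stationary_distribution_on_def)

text \<open>The mean distance between the tokens is finite and stationary, so it cancels from the
  averaged \<open>mean_dist_le\<close>.\<close>

lemma drift_balance:
  "0 \<le> (\<Sum>p\<in>VV. pmf s p * drift (fst p)) + (\<Sum>p\<in>VV. pmf s p * drift (snd p))"
proof -
  let ?D = "\<lambda>p. real (d (fst p) (snd p))"
  have "(\<Sum>p\<in>VV. pmf s p * ?D p) = (\<Sum>p\<in>VV. pmf s p * (\<Sum>q\<in>VV. pmf (T p) q * ?D q))"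
    using stationary_mean[OF _ stationary, of ?D] by simp
  also have "\<dots> \<le> (\<Sum>p\<in>VV. pmf s p * (?D p + drift (fst p) + drift (snd p)))"
  proof (rule sum_mono)
    fix p
    show "pmf s p * (\<Sum>q\<in>VV. pmf (T p) q * ?D q) \<le>
        pmf s p * (?D p + drift (fst p) + drift (snd p))"
      using mean_dist_le[of p] by (cases "p \<in> set_pmf s") (auto simp: set_pmf_iff intro: mult_left_mono)
  qed
  finally show ?thesis by (simp add: algebra_simps sum.distrib)
qed

text \<open>The total distance to all vertices serves as potential; its stationary mean cancels,
  leaving the 1 from \<open>srw_mean_total_dist\<close> against the drift term. The projection
  \<open>\<pi>\<close> treats both tokens at once.\<close>

lemma mean_drift:
  assumes "\<pi> = fst \<or> \<pi> = snd"
  shows "(real (card (verts G)) - 1) * (\<Sum>p\<in>VV. pmf s p * drift (\<pi> p)) = - 1"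
proof -
  let ?g = "\<lambda>x. \<Sum>v\<in>verts G. real (d x v)" and ?m = "real (card (verts G)) - 1"
  have "(\<Sum>p\<in>VV. pmf s p * ?g (\<pi> p)) = (\<Sum>p\<in>VV. pmf s p * (\<Sum>q\<in>VV. pmf (T p) q * ?g (\<pi> q)))"
    using stationary_mean[OF _ stationary, of "\<lambda>q. ?g (\<pi> q)"] by simp
  also have "\<dots> = (\<Sum>p\<in>VV. pmf s p * (?g (\<pi> p) + 1 + ?m * drift (\<pi> p)))"
  proof (rule sum_s_cong)
    fix p assume p: "p \<in> set_pmf s"
    have "(\<Sum>q\<in>VV. pmf (T p) q * ?g (\<pi> q)) = (\<Sum>w\<in>verts G. srw_prob G (\<pi> p) w * ?g w)"
      using assms mean_fst[OF p, of ?g] mean_snd[OF p, of ?g] by auto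
    also have "\<dots> = ?g (\<pi> p) + 1 + ?m * drift (\<pi> p)"
      unfolding drift_def using assms state[OF p] nbrs_ne[OF p] by (intro srw_mean_total_dist) auto
    finally show "(\<Sum>q\<in>VV. pmf (T p) q * ?g (\<pi> q)) = ?g (\<pi> p) + 1 + ?m * drift (\<pi> p)" .
  qed
  also have "\<dots> = (\<Sum>p\<in>VV. pmf s p * ?g (\<pi> p)) + (\<Sum>p\<in>VV. pmf s p)
      + ?m * (\<Sum>p\<in>VV. pmf s p * drift (\<pi> p))"
    by (simp only: distrib_left sum.distrib mult_1_right) (simp add: sum_distrib_left mult_ac)
  finally show ?thesis by (simp add: sum_s)
qed

lemma contradiction: False
proof -
  have "verts G \<noteq> {}" using state(1) set_pmf_not_empty[of s] by blast
  then have "0 \<le> real (card (verts G)) - 1"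
    by (simp add: Suc_le_eq card_gt_0_iff)
  \<comment> \<open>By \<open>mean_drift\<close> each token contributes -1, so this product is -2.
    Multiplying by the vertex count minus one avoids a division.\<close>
  then have "0 \<le> (real (card (verts G)) - 1) *
      ((\<Sum>p\<in>VV. pmf s p * drift (fst p)) + (\<Sum>p\<in>VV. pmf s p * drift (snd p)))"
    using drift_balance by (rule mult_nonneg_nonneg)
  then show False using mean_drift[of fst] mean_drift[of snd] by (simp add: distrib_left)
qed

end

theorem theorem4p7:
  fixes G :: "('a, 'b) pre_digraph"
  assumes "finite_tree G"
  shows "\<not> (\<exists>T s. uniform_avoidance_coupling G T s)"
proof
  assume "\<exists>T s. uniform_avoidance_coupling G T s"
  then obtain T s where "uniform_avoidance_coupling G T s" by blast
  with finite_tree_imp_tree_graph[OF assms] have "tree_coupling G T s"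
    by (simp add: tree_coupling_def tree_coupling_axioms_def)
  then show False by (rule tree_coupling.contradiction)
qed

end
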